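(* Let $X$ be a compact topological space and $f\colon X\to X$ a continuous map. If $(X,f)$ is chain mixing and has the finite shadowing property, then $(X,f)$ has the open cover specification property.
   Context: $\mathbb{N}=\{1,2,\dots\}$; for integers $a\le b$, $[a,b]$ denotes the set of integers $k$ with $a\le k\le b$. For an open cover $\mathcal{V}$ of $X$, a finite $\mathcal{V}$-pseudo-orbit is a finite sequence $(x_i)_{i=0}^m$ in $X$ such that for each $0\le i<m$ there is $V\in\mathcal{V}$ with $(f(x_i),x_{i+1})\in V\times V$. For an open cover $\mathcal{U}$, it is $\mathcal{U}$-traced by $y\in X$ if for each $0\le i\le m$ there is $U\in\mathcal{U}$ with $(f^i(y),x_i)\in U\times U$. $(X,f)$ is chain mixing if for every open cover $\mathcal{U}$ of $X$ and all $u,v\in X$ there is $N\in\mathbb{N}$ such that for every $n\ge N$ there is a finite $\mathcal{U}$-pseudo-orbit $(x_i)_{i=0}^n$ with $x_0=u$ and $x_n=v$. $(X,f)$ has the finite shadowing property if for every open cover $\mathcal{U}$ of $X$ there is an open cover $\mathcal{V}$ of $X$ such that every finite $\mathcal{V}$-pseudo-orbit is $\mathcal{U}$-traced by some point of $X$. For $N\in\mathbb{N}$, an $N$-spaced specification $\xi=\{f^{[a_i,b_i]}(x_i)\}_{i=1}^n$ consists of $n\in\mathbb{N}$, points $x_1,\dots,x_n\in X$ and non-negative integers $a_1\le b_1<a_2\le b_2<\cdots<a_n\le b_n$ with $a_{i+1}-b_i\ge N$ for $1\le i\le n-1$. A point $y\in X$ $\mathcal{U}$-traces $\xi$ if for every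 $i\in[1,n]$ and $k\in[a_i,b_i]$ there is $U\in\mathcal{U}$ with $(f^k(y),f^k(x_i))\in U\times U$. $(X,f)$ has the open cover specification property if for every open cover $\mathcal{U}$ of $X$ there is $N\in\mathbb{N}$ such that every $N$-spaced specification is $\mathcal{U}$-traced by some $y\in X$. *)

theory Defs
  imports "HOL-Analysis.Analysis"
begin

definition open_cover :: "'a topology \<Rightarrow> 'a set set \<Rightarrow> bool" where
  "open_cover X \<U> \<longleftrightarrow> (\<forall>U\<in>\<U>. openin X U) \<and> \<Union>\<U> = topspace X"

text \<open>A finite sequence \<open>(x\<^sub>i)\<close> with \<open>i = 0, \<dots>, m\<close> is a function on the naturals together
  with \<open>m\<close>; its values at arguments greater than \<open>m\<close> are irrelevant.\<close>

definition pseudo_orbit ::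
  "'a topology \<Rightarrow> ('a \<Rightarrow> 'a) \<Rightarrow> 'a set set \<Rightarrow> nat \<Rightarrow> (nat \<Rightarrow> 'a) \<Rightarrow> bool" where
  "pseudo_orbit X f \<V> m x \<longleftrightarrow>
     (\<forall>i\<le>m. x i \<in> topspace X) \<and>
     (\<forall>i<m. \<exists>V\<in>\<V>. (f (x i), x (Suc i)) \<in> V \<times> V)"

definition traces_pseudo_orbit ::
  "('a \<Rightarrow> 'a) \<Rightarrow> 'a set set \<Rightarrow> nat \<Rightarrow> (nat \<Rightarrow> 'a) \<Rightarrow> 'a \<Rightarrow> bool" where
  "traces_pseudo_orbit f \<U> m x y \<longleftrightarrow> (\<forall>i\<le>m. \<exists>U\<in>\<U>. ((f ^^ i) y, x i) \<in> U \<times> U)"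

definition chain_mixing :: "'a topology \<Rightarrow> ('a \<Rightarrow> 'a) \<Rightarrow> bool" where
  "chain_mixing X f \<longleftrightarrow>
     (\<forall>\<U>. open_cover X \<U> \<longrightarrow>
       (\<forall>u\<in>topspace X. \<forall>v\<in>topspace X.
         \<exists>N\<ge>1. \<forall>n\<ge>N. \<exists>x. pseudo_orbit X f \<U> n x \<and> x 0 = u \<and> x n = v))"

definition finite_shadowing :: "'a topology \<Rightarrow> ('a \<Rightarrow> 'a) \<Rightarrow> bool" where
  "finite_shadowing X f \<longleftrightarrow>
     (\<forall>\<U>. open_cover X \<U> \<longrightarrow>
       (\<exists>\<V>. open_cover X \<V> \<and>
         (\<forall>m x. pseudo_orbit X f \<V> m x \<longrightarrow>
           (\<exists>y\<in>topspace X. traces_pseudo_orbit f \<U> m x y))))"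

text \<open>The specification with \<open>n\<close> orbit segments is given by the functions \<open>x\<close>, \<open>a\<close>, \<open>b\<close>,
  of which only the values at \<open>1, \<dots>, n\<close> matter.\<close>

definition spaced_specification ::
  "'a topology \<Rightarrow> nat \<Rightarrow> nat \<Rightarrow> (nat \<Rightarrow> 'a) \<Rightarrow> (nat \<Rightarrow> nat) \<Rightarrow> (nat \<Rightarrow> nat) \<Rightarrow> bool" where
  "spaced_specification X N n x a b \<longleftrightarrow>
     n \<ge> 1 \<and>
     (\<forall>i\<in>{1..n}. x i \<in> topspace X) \<and>
     (\<forall>i\<in>{1..n}. a i \<le> b i) \<and>
     (\<forall>i\<in>{1..<n}. b i < a (Suc i) \<and> b i + N \<le> a (Suc i))"

definition traces_specification ::
  "('a \<Rightarrow> 'a) \<Rightarrow> 'a set set \<Rightarrow> nat \<Rightarrow> (nat \<Rightarrow> 'a) \<Rightarrow> (nat \<Rightarrow> nat) \<Rightarrow> (nat \<Rightarrow> nat) \<Rightarrow> 'a \<Rightarrow> bool"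
  where
  "traces_specification f \<U> n x a b y \<longleftrightarrow>
     (\<forall>i\<in>{1..n}. \<forall>k\<in>{a i..b i}. \<exists>U\<in>\<U>. ((f ^^ k) y, (f ^^ k) (x i)) \<in> U \<times> U)"

definition open_cover_specification :: "'a topology \<Rightarrow> ('a \<Rightarrow> 'a) \<Rightarrow> bool" where
  "open_cover_specification X f \<longleftrightarrow>
     (\<forall>\<U>. open_cover X \<U> \<longrightarrow>
       (\<exists>N\<ge>1. \<forall>n x a b. spaced_specification X N n x a b \<longrightarrow>
         (\<exists>y\<in>topspace X. traces_specification f \<U> n x a b y)))"

end

theory Submission
  imports Defs
begin

text \<open>The proof concatenates the prescribed orbit segments into one pseudo-orbit and shadows it.
  If \<open>\<V>\<close> is the cover that finite shadowing provides for \<open>\<U>\<close>, two consecutive segments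
  \<open>f\<^bsup>[a i, b i]\<^esup> (x i)\<close> and \<open>f\<^bsup>[a (i + 1), b (i + 1)]\<^esup> (x (i + 1))\<close> have to be joined by a
  \<open>\<V>\<close>-pseudo-orbit of length exactly \<open>a (i + 1) - b i\<close>. Chain mixing gives such links for all large
  lengths, but with a threshold that depends on the two endpoints, whereas the specification property
  asks for one threshold for all specifications.

  Uniformity comes from compactness: after passing to a finite subcover of \<open>\<V>\<close>, only finitely many
  situations can occur. Whether \<open>u\<close> may begin, or \<open>v\<close> may end, a
  given pseudo-orbit depends only on which members of the cover contain \<open>f u\<close>, respectively \<open>v\<close>.
  So the threshold for \<open>(u, v)\<close> may be taken to depend only on these two subsets of a finite cover,
  and a maximum over finitely many values is a uniform threshold (\<open>chain_mixing_uniform\<close>). The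
  segments are then glued by induction on their number (\<open>pseudo_orbit_through_specification\<close>).\<close>

lemma compact_space_finite_subcover:
  assumes "compact_space X" and "open_cover X \<V>"
  obtains \<F> where "finite \<F>" and "\<F> \<subseteq> \<V>" and "open_cover X \<F>"
proof -
  have "\<exists>\<F>. finite \<F> \<and> \<F> \<subseteq> \<V> \<and> \<Union>\<F> = topspace X"
    using assms(1)[unfolded compact_space, THEN spec[of _ \<V>]] assms(2)
    unfolding open_cover_def by (rule mp)
  then show thesis
    using that assms(2) unfolding open_cover_def by (meson subsetD)
qed

lemma pseudo_orbit_mono:
  assumes "pseudo_orbit X f \<F> m x" and "\<F> \<subseteq> \<V>"
  shows "pseudo_orbit X f \<V> m x"
  using assms unfolding pseudo_orbit_def by blast

lemma pseudo_orbit_orbit: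
  assumes f: "f \<in> topspace X \<rightarrow> topspace X" and cover: "topspace X \<subseteq> \<Union>\<V>"
    and p: "p \<in> topspace X"
  shows "pseudo_orbit X f \<V> m (\<lambda>k. (f ^^ k) p)"
proof -
  have iter: "(f ^^ k) p \<in> topspace X" for k
    using f p by (induction k) auto
  have "\<exists>V\<in>\<V>. (f ((f ^^ k) p), (f ^^ Suc k) p) \<in> V \<times> V" for k
    using iter[of "Suc k"] cover by auto
  with iter show ?thesis
    unfolding pseudo_orbit_def by blast
qed

lemma pseudo_orbit_append:
  assumes x: "pseudo_orbit X f \<V> m x" and y: "pseudo_orbit X f \<V> n y" and "x m = y 0"
  shows "pseudo_orbit X f \<V> (m + n) (\<lambda>k. if k \<le> m then x k else y (k - m))"
    (is "pseudo_orbit X f \<V> (m + n) ?z")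
proof -
  have "?z i \<in> topspace X" if "i \<le> m + n" for i
    using x y that unfolding pseudo_orbit_def by auto
  moreover have "\<exists>V\<in>\<V>. (f (?z i), ?z (Suc i)) \<in> V \<times> V" if "i < m + n" for i
  proof (cases "i < m")
    case True
    then show ?thesis
      using x unfolding pseudo_orbit_def by simp
  next
    case False
    then have "?z i = y (i - m)" "?z (Suc i) = y (Suc (i - m))" "i - m < n"
      using \<open>x m = y 0\<close> that by (auto simp: Suc_diff_le)
    then show ?thesis
      using y unfolding pseudo_orbit_def by simp
  qed
  ultimately show ?thesis
    unfolding pseudo_orbit_def by blast
qed

text \<open>The initial point \<open>x 0\<close> enters the step conditions only through \<open>f (x 0)\<close>, and the final
  point \<open>x n\<close> only as a point reached, never through its image. Both can therefore be exchanged for points that the cover does not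
  distinguish from them in these roles.\<close>

lemma pseudo_orbit_change_endpoints:
  assumes x: "pseudo_orbit X f \<V> n x" and n: "n \<ge> 1"
    and "u \<in> topspace X" and "v \<in> topspace X"
    and u: "\<And>V. V \<in> \<V> \<Longrightarrow> f (x 0) \<in> V \<Longrightarrow> f u \<in> V"
    and v: "\<And>V. V \<in> \<V> \<Longrightarrow> x n \<in> V \<Longrightarrow> v \<in> V"
  shows "pseudo_orbit X f \<V> n (x(0 := u, n := v))"
proof -
  let ?y = "x(0 := u, n := v)"
  have "\<exists>V\<in>\<V>. (f (?y i), ?y (Suc i)) \<in> V \<times> V" if "i < n" for i
  proof -
    have "\<exists>V\<in>\<V>. (f (x i), x (Suc i)) \<in> V \<times> V"
      using x that unfolding pseudo_orbit_def by blast
    then obtain V where "V \<in> \<V>" "f (x i) \<in> V" "x (Suc i) \<in> V"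
      by blast
    moreover from this have "f (?y i) \<in> V" "?y (Suc i) \<in> V"
      using u v that by auto
    ultimately show ?thesis
      by blast
  qed
  then show ?thesis
    using x \<open>u \<in> topspace X\<close> \<open>v \<in> topspace X\<close> unfolding pseudo_orbit_def by auto
qed

text \<open>The pair of subsets of \<open>\<F>\<close> formed by the members containing \<open>f u\<close> and by those containing
  \<open>v\<close> takes finitely many values. By the previous lemma, a threshold for one pair \<open>(u, v)\<close> serves
  every pair with the same value.\<close>

lemma chain_mixing_uniform:
  assumes mixing: "chain_mixing X f" and cover: "open_cover X \<F>" and fin: "finite \<F>"
  obtains N where "N \<ge> 1"
    and "\<forall>u\<in>topspace X. \<forall>v\<in>topspace X. \<forall>n\<ge>N.
           \<exists>x. pseudo_orbit X f \<F> n x \<and> x 0 = u \<and> x n = v"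
proof -
  define type where "type = (\<lambda>(u, v). ({V \<in> \<F>. f u \<in> V}, {V \<in> \<F>. v \<in> V}))"
  define T where "T = type ` (topspace X \<times> topspace X)"
  have "T \<subseteq> Pow \<F> \<times> Pow \<F>"
    unfolding T_def type_def by auto
  then have "finite T"
    using fin finite_subset by blast
  have "\<exists>N\<ge>1. \<forall>u\<in>topspace X. \<forall>v\<in>topspace X. type (u, v) = t \<longrightarrow>
          (\<forall>n\<ge>N. \<exists>x. pseudo_orbit X f \<F> n x \<and> x 0 = u \<and> x n = v)" if t: "t \<in> T" for t
  proof -
    obtain u v where uv: "u \<in> topspace X" "v \<in> topspace X" "t = type (u, v)"
      using t unfolding T_def by auto
    then obtain N where "N \<ge> 1"
      and N: "\<And>n. n \<ge> N \<Longrightarrow> \<exists>x. pseudo_orbit X f \<F> n x \<and> x 0 = u \<and> x n = v"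
      using mixing cover unfolding chain_mixing_def by blast
    have "\<exists>x. pseudo_orbit X f \<F> n x \<and> x 0 = u' \<and> x n = v'"
      if "u' \<in> topspace X" "v' \<in> topspace X" "type (u', v') = t" "n \<ge> N" for u' v' n
    proof -
      obtain x where x: "pseudo_orbit X f \<F> n x" "x 0 = u" "x n = v"
        using N \<open>n \<ge> N\<close> by blast
      have "f u' \<in> V" if "V \<in> \<F>" "f (x 0) \<in> V" for V
        using that x(2) uv(3) \<open>type (u', v') = t\<close> unfolding type_def by auto
      moreover have "v' \<in> V" if "V \<in> \<F>" "x n \<in> V" for V
        using that x(3) uv(3) \<open>type (u', v') = t\<close> unfolding type_def by auto
      moreover have "n \<ge> 1"
        using \<open>N \<ge> 1\<close> \<open>n \<ge> N\<close> by simp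
      ultimately have "pseudo_orbit X f \<F> n (x(0 := u', n := v'))"
        using pseudo_orbit_change_endpoints[OF x(1)] that(1,2) by simp
      with \<open>n \<ge> 1\<close> show ?thesis
        by (intro exI[of _ "x(0 := u', n := v')"]) auto
    qed
    with \<open>N \<ge> 1\<close> show ?thesis
      by blast
  qed
  then have "\<forall>t\<in>T. \<exists>N. \<forall>u\<in>topspace X. \<forall>v\<in>topspace X. type (u, v) = t \<longrightarrow>
          (\<forall>n\<ge>N. \<exists>x. pseudo_orbit X f \<F> n x \<and> x 0 = u \<and> x n = v)"
    by blast
  from bchoice[OF this]
  obtain M where M: "\<forall>t\<in>T. \<forall>u\<in>topspace X. \<forall>v\<in>topspace X. type (u, v) = t \<longrightarrow>
          (\<forall>n\<ge>M t. \<exists>x. pseudo_orbit X f \<F> n x \<and> x 0 = u \<and> x n = v)"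
    by (rule exE)
  obtain N where N: "\<And>t. t \<in> T \<Longrightarrow> M t \<le> N"
    using \<open>finite T\<close> finite_nat_set_iff_bounded_le[of "M ` T"] by auto
  show thesis
  proof (rule that[of "Suc N"], safe)
    fix u v n
    assume "u \<in> topspace X" "v \<in> topspace X" "Suc N \<le> n"
    then have "type (u, v) \<in> T" "M (type (u, v)) \<le> n"
      using N[of "type (u, v)"] unfolding T_def by auto
    with M \<open>u \<in> topspace X\<close> \<open>v \<in> topspace X\<close>
    show "\<exists>x. pseudo_orbit X f \<F> n x \<and> x 0 = u \<and> x n = v"
      by blast
  qed simp
qed

text \<open>Time is kept synchronised: the pseudo-orbit starts at time \<open>0\<close> and agrees with the orbit of
  \<open>x i\<close> at the times \<open>k\<close> in \<open>[a i, b i]\<close> themselves. The initial stretch before time \<open>a 1\<close> is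
  filled by the true orbit of \<open>x 1\<close>, the gaps by links of the prescribed lengths. The bound
  \<open>b i \<le> b n\<close> belongs to the induction because an extension beyond time \<open>b n\<close> must leave all
  earlier segments unchanged; it also places every segment within the range of the pseudo-orbit.\<close>

lemma pseudo_orbit_through_specification:
  assumes f: "f \<in> topspace X \<rightarrow> topspace X" and cover: "topspace X \<subseteq> \<Union>\<V>"
    and link: "\<forall>u\<in>topspace X. \<forall>v\<in>topspace X. \<forall>n\<ge>N.
           \<exists>w. pseudo_orbit X f \<V> n w \<and> w 0 = u \<and> w n = v"
    and spec: "spaced_specification X N n x a b"
  shows "\<exists>z. pseudo_orbit X f \<V> (b n) z \<and>
    (\<forall>i\<in>{1..n}. b i \<le> b n \<and> (\<forall>k\<in>{a i..b i}. z k = (f ^^ k) (x i)))"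
proof -
  have iter: "(f ^^ k) p \<in> topspace X" if "p \<in> topspace X" for k p
    using f that by (induction k) auto
  have "n \<ge> 1"
    using spec unfolding spaced_specification_def by blast
  then have "spaced_specification X N n x a b \<longrightarrow>
    (\<exists>z. pseudo_orbit X f \<V> (b n) z \<and>
         (\<forall>i\<in>{1..n}. b i \<le> b n \<and> (\<forall>k\<in>{a i..b i}. z k = (f ^^ k) (x i))))"
  proof (induction n rule: dec_induct)
    case base
    have "pseudo_orbit X f \<V> (b 1) (\<lambda>k. (f ^^ k) (x 1))" if "x 1 \<in> topspace X"
      using pseudo_orbit_orbit[OF f cover that] .
    then show ?case
      unfolding spaced_specification_def by auto
  next
    case (step n)
    show ?case
    proof
      assume spec: "spaced_specification X N (Suc n) x a b"
      let ?a = "a (Suc n)" and ?b = "b (Suc n)" and ?p = "x (Suc n)"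
      have "spaced_specification X N n x a b"
        using spec \<open>1 \<le> n\<close> unfolding spaced_specification_def by auto
      then obtain z where z: "pseudo_orbit X f \<V> (b n) z"
        and seg: "\<And>i. i \<in> {1..n} \<Longrightarrow> b i \<le> b n"
          "\<And>i k. i \<in> {1..n} \<Longrightarrow> k \<in> {a i..b i} \<Longrightarrow> z k = (f ^^ k) (x i)"
        using step.IH by blast
      have pts: "x n \<in> topspace X" "?p \<in> topspace X" and ab: "a n \<le> b n" "?a \<le> ?b"
        using spec \<open>1 \<le> n\<close> unfolding spaced_specification_def by auto
      have "n \<in> {1..<Suc n}"
        using \<open>1 \<le> n\<close> by simp
      then have "b n < ?a \<and> b n + N \<le> ?a"
        using spec unfolding spaced_specification_def by blast
      then have gap: "b n < ?a" "N \<le> ?a - b n"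
        by linarith+
      have zb: "z (b n) = (f ^^ b n) (x n)"
        using seg(2)[of n "b n"] \<open>1 \<le> n\<close> ab(1) by simp
      obtain w where w: "pseudo_orbit X f \<V> (?a - b n) w"
        and w0: "w 0 = (f ^^ b n) (x n)" and w1: "w (?a - b n) = (f ^^ ?a) ?p"
        using link iter[OF pts(1), of "b n"] iter[OF pts(2), of ?a] gap(2) by blast
      define z1 where "z1 = (\<lambda>k. if k \<le> b n then z k else w (k - b n))"
      have "pseudo_orbit X f \<V> (b n + (?a - b n)) z1"
        unfolding z1_def by (rule pseudo_orbit_append[OF z w]) (simp add: zb w0)
      then have z1: "pseudo_orbit X f \<V> ?a z1"
        using gap(1) by simp
      have z1a: "z1 ?a = (f ^^ ?a) ?p"
        unfolding z1_def using gap(1) w1 by simp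
      define z2 where "z2 = (\<lambda>k. if k \<le> ?a then z1 k else (f ^^ (k - ?a)) ((f ^^ ?a) ?p))"
      have "pseudo_orbit X f \<V> (?a + (?b - ?a)) z2"
        unfolding z2_def
        by (rule pseudo_orbit_append[OF z1 pseudo_orbit_orbit[OF f cover iter[OF pts(2)]]])
          (simp add: z1a)
      then have z2: "pseudo_orbit X f \<V> ?b z2"
        using ab(2) by simp
      have old: "z2 k = z k" if "k \<le> b n" for k
        unfolding z2_def z1_def using that gap(1) by simp
      have new: "z2 k = (f ^^ k) ?p" if "k \<ge> ?a" for k
      proof (cases "k = ?a")
        case True
        then show ?thesis
          unfolding z2_def using z1a by simp
      next
        case False
        then have "z2 k = (f ^^ ((k - ?a) + ?a)) ?p"
          unfolding z2_def funpow_add using that by simp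
        then show ?thesis
          using that by simp
      qed
      have "b i \<le> ?b \<and> (\<forall>k\<in>{a i..b i}. z2 k = (f ^^ k) (x i))" if "i \<in> {1..Suc n}" for i
      proof (cases "i = Suc n")
        case True
        then show ?thesis
          using new by simp
      next
        case False
        then have i: "i \<in> {1..n}"
          using that by auto
        then have "b i \<le> ?b"
          using seg(1)[OF i] gap(1) ab(2) by linarith
        moreover have "z2 k = (f ^^ k) (x i)" if "k \<in> {a i..b i}" for k
          using that old[of k] seg(1)[OF i] seg(2)[OF i that] by simp
        ultimately show ?thesis
          by blast
      qed
      then show "\<exists>z. pseudo_orbit X f \<V> ?b z \<and>
          (\<forall>i\<in>{1..Suc n}. b i \<le> ?b \<and> (\<forall>k\<in>{a i..b i}. z k = (f ^^ k) (x i)))"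
        using z2 by blast
    qed
  qed
  then show ?thesis
    using spec by blast
qed

theorem theorem3p2:
  fixes X :: "'a topology" and f :: "'a \<Rightarrow> 'a"
  assumes "compact_space X"
    and "continuous_map X X f"
    and "chain_mixing X f"
    and "finite_shadowing X f"
  shows "open_cover_specification X f"
  unfolding open_cover_specification_def
proof (intro allI impI)
  fix \<U>
  assume "open_cover X \<U>"
  then obtain \<V> where \<V>: "open_cover X \<V>"
    and shadow: "\<And>m x. pseudo_orbit X f \<V> m x \<Longrightarrow>
          \<exists>y\<in>topspace X. traces_pseudo_orbit f \<U> m x y"
    using assms(4) unfolding finite_shadowing_def by blast
  obtain \<F> where fin: "finite \<F>" and sub: "\<F> \<subseteq> \<V>" and \<F>: "open_cover X \<F>"
    using compact_space_finite_subcover[OF assms(1) \<V>] .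
  obtain N where "N \<ge> 1"
    and link: "\<forall>u\<in>topspace X. \<forall>v\<in>topspace X. \<forall>n\<ge>N.
           \<exists>w. pseudo_orbit X f \<F> n w \<and> w 0 = u \<and> w n = v"
    using chain_mixing_uniform[OF assms(3) \<F> fin] .
  have f: "f \<in> topspace X \<rightarrow> topspace X"
    using assms(2) by (rule continuous_map_funspace)
  have cover: "topspace X \<subseteq> \<Union>\<F>"
    using \<F> unfolding open_cover_def by simp
  have "\<exists>y\<in>topspace X. traces_specification f \<U> n x a b y"
    if spec: "spaced_specification X N n x a b" for n x a b
  proof -
    obtain z where "pseudo_orbit X f \<F> (b n) z"
      and z: "\<forall>i\<in>{1..n}. b i \<le> b n \<and> (\<forall>k\<in>{a i..b i}. z k = (f ^^ k) (x i))"
      using pseudo_orbit_through_specification[OF f cover link spec] by blast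
    then have "pseudo_orbit X f \<V> (b n) z"
      using pseudo_orbit_mono sub by blast
    then obtain y where "y \<in> topspace X" and y: "traces_pseudo_orbit f \<U> (b n) z y"
      using shadow by blast
    have "\<exists>U\<in>\<U>. ((f ^^ k) y, (f ^^ k) (x i)) \<in> U \<times> U" if "i \<in> {1..n}" "k \<in> {a i..b i}" for i k
    proof -
      have "b i \<le> b n" "z k = (f ^^ k) (x i)"
        using z that by blast+
      moreover from this have "k \<le> b n"
        using that(2) by simp
      ultimately show ?thesis
        using y unfolding traces_pseudo_orbit_def by metis
    qed
    then have "traces_specification f \<U> n x a b y"
      unfolding traces_specification_def by blast
    with \<open>y \<in> topspace X\<close> show ?thesis
      by blast
  qed
  with \<open>N \<ge> 1\<close> show "\<exists>N\<ge>1. \<forall>n x a b. spaced_specification X N n x a b \<longrightarrow>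
      (\<exists>y\<in>topspace X. traces_specification f \<U> n x a b y)"
    by blast
qed

end
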